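(* Let $\{\epsilon_i\}_{i\ge 0}\subset(0,1)$ be such that $\sup_i\epsilon_i<1$ and the limit $\zeta(\{\epsilon_i\})=\lim_{k\to\infty}\frac1k\sum_{i=0}^{k-1}\frac{1}{1-\epsilon_i}$ exists. Consider communication over the tandem of independent binary erasure channels with erasure probabilities $\epsilon_0,\epsilon_1,\dots$ with local information only (no global state information). (i) (Constant message size.) For every $m\in\mathbb N$ (with $m\ge1$) and every sequence $\{\xi_k\}_{k\ge1}\subset(0,1)$ with $\xi_k\to0$ and $\lim_{k\to\infty}\frac1k\log(1/\xi_k)=0$, the information velocity is $$v_m(\{\epsilon_i\},\{\xi_i\})=\frac{1}{\zeta(\{\epsilon_i\})}.$$ (ii) (Polynomial message size.) For every $\rho\in(0,1/2)$ and every sequence $\{\xi_k\}_{k\ge1}\subset(0,1)$ with $\xi_k\to0$ and $\lim_{k\to\infty}\frac{1}{k^{1-2\rho}}\log(1/\xi_k)=0$, the information velocity for message sizes $m=m_k=\Theta(k^\rho)$ is $$v_{\rho\text{-poly}}(\{\epsilon_i\},\{\xi_i\})=\frac{1}{\zeta(\{\epsilon_i\})}.$$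
   Context: Network. For $k\ge1$ the tandem has nodes $0,1,\dots,k$. For $i=0,\dots,k-1$, node $i$ is connected to node $i+1$ by the $i$-th binary erasure channel with erasure probability $\epsilon_i$: at each time $n=1,2,\dots$ node $i$ sends $X_i[n]\in\{0,1\}$ and node $i+1$ observes $Y_i[n]=X_i[n]$ if $S_i[n]=1$ and $Y_i[n]=\ast$ (erasure) if $S_i[n]=0$. The channel states $S_i[n]=\mathbf 1\{Y_i[n]\neq\ast\}$ are independent over all $i,n$, independent of the message, with $\Pr\{S_i[n]=1\}=1-\epsilon_i$. The message $M$ is uniform on $\{0,1,\dots,2^m-1\}$ ($m$ bits, $m\ge 1$). Local information (no global state information): $X_0[n]$ is a function of $M$; for $i\ge1$, $X_i[n]$ is a function of $Y_{i-1}[1],\dots,Y_{i-1}[n-1]$. After $t$ time instances node $k$ outputs an estimate $\hat M_{k,t}$, a function of $Y_{k-1}[1],\dots,Y_{k-1}[t]$. Minimum delay: $t^*_{m,k}(\{\epsilon_i\}_{i=0}^{k-1},\xi)$ is the infimum of those $t$ for which there exist encoding functions (at nodes $0,\dots,k-1$) and a decoding function (at node $k$) such that $\Pr\{\hat M_{k,t}\ne M\}<\xi$. Information velocity: $v_\triangle(\{\epsilon_i\},\{\xi_i\})=\liminf_{k\to\infty}\dfrac{k}{t^*_{m,k}(\{\epsilon_i\}_{i=0}^{k-1},\xi_k)}$, where $\triangle$ specifies how the message size depends on $k$: $\triangle=m$ means the message size is the fixed constant $m$; $\triangle=\rho\text{-poly}$ means the message size is $m=m_k=\Theta(k^\rho)$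 (the statement is for any such sequence of positive integers). *)

theory Defs
  imports "HOL-Probability.Probability" "HOL-Library.Landau_Symbols"
begin

text \<open>
  Channel \<open>i\<close> connects node \<open>i\<close> to node \<open>i + 1\<close>; times are \<open>n = 1, 2, \<dots>\<close>. A channel state
  realization is \<open>S :: nat \<times> nat \<Rightarrow> bool\<close>, where \<open>S (i, n)\<close> says that the symbol sent over
  channel \<open>i\<close> at time \<open>n\<close> is not erased. A channel output is a \<open>bool option\<close>, where \<open>None\<close>
  is the erasure symbol.
\<close>

definition erase :: "(nat \<times> nat \<Rightarrow> bool) \<Rightarrow> nat \<Rightarrow> (nat \<Rightarrow> bool) \<Rightarrow> nat \<Rightarrow> bool option" where
  "erase S i x n = (if S (i, n) then Some (x n) else None)"

text \<open>
  \<open>src n M\<close> is the symbol sent by node \<open>0\<close> at time \<open>n\<close> for message \<open>M\<close>, and \<open>enc i n ys\<close> the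
  symbol sent by node \<open>i \<ge> 1\<close> at time \<open>n\<close> when it has observed the list \<open>ys\<close> at the times
  \<open>1, \<dots>, n - 1\<close>. Neither has access to \<open>S\<close> otherwise.
\<close>

primrec channel_input ::
  "(nat \<Rightarrow> nat \<Rightarrow> bool) \<Rightarrow> (nat \<Rightarrow> nat \<Rightarrow> bool option list \<Rightarrow> bool) \<Rightarrow>
   nat \<Rightarrow> (nat \<times> nat \<Rightarrow> bool) \<Rightarrow> nat \<Rightarrow> nat \<Rightarrow> bool" where
  "channel_input src enc M S 0 = (\<lambda>n. src n M)"
| "channel_input src enc M S (Suc i) =
     (\<lambda>n. enc (Suc i) n (map (erase S i (channel_input src enc M S i)) [1..<n]))"

definition channel_output ::
  "(nat \<Rightarrow> nat \<Rightarrow> bool) \<Rightarrow> (nat \<Rightarrow> nat \<Rightarrow> bool option list \<Rightarrow> bool) \<Rightarrow>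
   nat \<Rightarrow> (nat \<times> nat \<Rightarrow> bool) \<Rightarrow> nat \<Rightarrow> nat \<Rightarrow> bool option" where
  "channel_output src enc M S i = erase S i (channel_input src enc M S i)"

text \<open>
  Joint law of the message and of the channel states. Only the states of the channels
  \<open>0, \<dots>, k - 1\<close> at the times \<open>1, \<dots>, t\<close> influence the estimate of node \<open>k\<close> at time \<open>t\<close>, so
  the law is restricted to these; \<open>Pi_pmf\<close> sets all other coordinates to \<open>False\<close>.
\<close>

definition tandem_pmf ::
  "nat \<Rightarrow> nat \<Rightarrow> nat \<Rightarrow> (nat \<Rightarrow> real) \<Rightarrow> (nat \<times> (nat \<times> nat \<Rightarrow> bool)) pmf" where
  "tandem_pmf m k t \<epsilon> =
     pair_pmf (pmf_of_set {0..<2 ^ m})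
       (Pi_pmf ({..<k} \<times> {1..t}) False (\<lambda>(i, n). bernoulli_pmf (1 - \<epsilon> i)))"

text \<open>Meaningful for \<open>k \<ge> 1\<close> only: node \<open>k\<close> observes channel \<open>k - 1\<close>.\<close>

definition error_prob ::
  "nat \<Rightarrow> nat \<Rightarrow> nat \<Rightarrow> (nat \<Rightarrow> real) \<Rightarrow> (nat \<Rightarrow> nat \<Rightarrow> bool) \<Rightarrow>
   (nat \<Rightarrow> nat \<Rightarrow> bool option list \<Rightarrow> bool) \<Rightarrow> (bool option list \<Rightarrow> nat) \<Rightarrow> real" where
  "error_prob m k t \<epsilon> src enc dec =
     measure_pmf.prob (tandem_pmf m k t \<epsilon>)
       {(M, S). dec (map (channel_output src enc M S (k - 1)) [1..<Suc t]) \<noteq> M}"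

text \<open>The infimum is taken in \<open>enat\<close>, so that it is infinite if no delay is achievable.\<close>

definition min_delay :: "nat \<Rightarrow> nat \<Rightarrow> (nat \<Rightarrow> real) \<Rightarrow> real \<Rightarrow> enat" where
  "min_delay m k \<epsilon> \<xi> =
     Inf {enat t | t. \<exists>src enc dec. error_prob m k t \<epsilon> src enc dec < \<xi>}"

text \<open>
  The message size may depend on the number of hops. Division is that of \<open>ereal\<close>: for
  \<open>k \<ge> 1\<close> the quotient is \<open>\<infinity>\<close> for delay \<open>0\<close> and \<open>0\<close> for infinite delay.
\<close>

definition info_velocity :: "(nat \<Rightarrow> nat) \<Rightarrow> (nat \<Rightarrow> real) \<Rightarrow> (nat \<Rightarrow> real) \<Rightarrow> ereal" where
  "info_velocity m \<epsilon> \<xi> =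
     liminf (\<lambda>k. ereal (real k) / ereal_of_enat (min_delay (m k) k \<epsilon> (\<xi> k)))"

definition mean_hop_delay :: "(nat \<Rightarrow> real) \<Rightarrow> nat \<Rightarrow> real" where
  "mean_hop_delay \<epsilon> k = (1 / real k) * (\<Sum>i<k. 1 / (1 - \<epsilon> i))"

definition zeta :: "(nat \<Rightarrow> real) \<Rightarrow> real" where
  "zeta \<epsilon> = lim (mean_hop_delay \<epsilon>)"

end

(*
  Converse: without any coding, the time at which a node can first know anything about the
  message is a first passage time, a sum of independent geometric variables with means
  1 / (1 - eps i). A Chernoff bound shows that before time (zeta - c) k node k sees, with
  high probability, an output that is the same for all messages, so its error is bounded away from 0.

  Achievability: one bit travels at speed 1 / zeta if "0" is never signalled: every node sends
  zeros until it receives a one, and ones from then on. The m bits use disjoint windows of length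
  w = O(log (m k / xi)), and the windows of node i start at (1 + delta) times the mean passage
  time to node i. The front of a bit relative to this schedule is a reflected random walk with
  negative drift, so it misses a window with probability exponentially small in w. The delay is
  (1 + delta) zeta k + m w, and m w = o(k) under both sets of hypotheses.
*)

theory Submission
  imports Defs "HOL-Real_Asymp.Real_Asymp"
begin

section \<open>Conditioning on one coordinate of a product law\<close>

lemma prob_bind_pmf:
  "measure_pmf.prob (bind_pmf M f) A = (\<integral>x. measure_pmf.prob (f x) A \<partial>measure_pmf M)"
proof -
  have eq: "measure_pmf.prob N A = pmf (map_pmf (\<lambda>x. x \<in> A) N) True" for N :: "'a pmf"
    by (simp add: pmf_map vimage_def)
  show ?thesis
    unfolding eq by (simp add: map_bind_pmf pmf_bind)
qed

text \<open>Neither \<open>E\<close> nor \<open>F\<close> depends on coordinate \<open>x\<close>, so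
  one may condition on it: a success leaves the event \<open>F\<close>, a failure leaves
  \<open>E\<close>, because \<open>F\<close> implies \<open>E\<close>.\<close>

lemma prob_Pi_pmf_bernoulli_coordinate:
  assumes fin: "finite I" and x: "x \<in> I"
    and p: "p x = bernoulli_pmf q" "0 \<le> q" "q \<le> 1"
    and E: "\<And>f b. E (f(x := b)) = E f" and F: "\<And>f b. F (f(x := b)) = F f"
    and sub: "\<And>f. F f \<Longrightarrow> E f"
  shows "measure_pmf.prob (Pi_pmf I d p) {f. F f \<or> E f \<and> \<not> f x} =
    q * measure_pmf.prob (Pi_pmf I d p) {f. F f} +
    (1 - q) * measure_pmf.prob (Pi_pmf I d p) {f. E f}"
proof -
  let ?N = "Pi_pmf (I - {x}) d p"
  have ins: "Pi_pmf I d p = p x \<bind> (\<lambda>y. map_pmf (\<lambda>f. f(x := y)) ?N)"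
    using Pi_pmf_insert'[of "I - {x}" x d p] fin x
    by (simp add: insert_absorb map_pmf_def)
  have split: "measure_pmf.prob (Pi_pmf I d p) A =
      q * measure_pmf.prob ?N {f. f(x := True) \<in> A} +
      (1 - q) * measure_pmf.prob ?N {f. f(x := False) \<in> A}" for A
    unfolding ins prob_bind_pmf using p by (simp add: vimage_def)
  have "{f. F f \<or> E f} = {f. E f}"
    using sub by auto
  then show ?thesis
    unfolding split by (simp add: E F algebra_simps)
qed

text \<open>
  First passage percolation: \<open>informed W S i n\<close> says that node \<open>i\<close> has something to forward at time
  \<open>n\<close> if a symbol on channel \<open>l\<close> counts only when it is sent by an informed node during the window
  \<open>W l\<close>. The converse uses unrestricted windows, the coding scheme one family of windows per bit.
\<close>

primrec informed :: "(nat \<Rightarrow> nat set) \<Rightarrow> (nat \<times> nat \<Rightarrow> bool) \<Rightarrow> nat \<Rightarrow> nat \<Rightarrow> bool" where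
  "informed W S 0 n = True"
| "informed W S (Suc i) n = (\<exists>n'<n. n' \<in> W i \<and> informed W S i n' \<and> S (i, n'))"

lemma informed_mono: "informed W S i n \<Longrightarrow> n \<le> n' \<Longrightarrow> informed W S i n'"
  by (cases i) (auto intro: less_le_trans)

lemma informed_pred: "informed W S (Suc i) n \<Longrightarrow> informed W S i n"
  by (auto intro: informed_mono)

text \<open>Only states at times before \<open>n\<close> decide whether a node is informed at
  \<open>n\<close>. This supplies the independence behind the one-step recursion.\<close>

lemma informed_update: "n \<le> t \<Longrightarrow> informed W (S((c, t) := b)) i n = informed W S i n"
proof (induction i arbitrary: n)
  case (Suc i)
  have "n' < n \<and> n' \<in> W i \<and> informed W (S((c, t) := b)) i n' \<and> (S((c, t) := b)) (i, n') \<longleftrightarrow>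
      n' < n \<and> n' \<in> W i \<and> informed W S i n' \<and> S (i, n')" for n'
  proof (cases "n' < n")
    case True
    then have "(i, n') \<noteq> (c, t)" "n' \<le> t" using Suc.prems by auto
    then have "(S((c, t) := b)) (i, n') = S (i, n')" by auto
    then show ?thesis using Suc.IH[OF \<open>n' \<le> t\<close>] by (simp only:)
  qed simp
  then show ?case by (simp only: informed.simps)
qed simp

text \<open>If node \<open>i\<close> is uninformed at \<open>n\<close>, it was so at all earlier
  times and has passed nothing on. Otherwise, as \<open>n\<close> lies in the window, node
  \<open>i + 1\<close> stays uninformed exactly when it was so and the current symbol is
  erased.\<close>

lemma not_informed_Suc:
  assumes "n \<in> W i"
  shows "\<not> informed W S (Suc i) (Suc n) \<longleftrightarrow>
    \<not> informed W S i n \<or> \<not> informed W S (Suc i) n \<and> \<not> S (i, n)"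
  using assms informed_pred[of W S i n] informed_mono[of W S i _ n]
  by (auto simp: less_Suc_eq)

abbreviation state_pmf :: "nat \<Rightarrow> nat \<Rightarrow> (nat \<Rightarrow> real) \<Rightarrow> (nat \<times> nat \<Rightarrow> bool) pmf" where
  "state_pmf k t \<epsilon> \<equiv> Pi_pmf ({..<k} \<times> {1..t}) False (\<lambda>(i, n). bernoulli_pmf (1 - \<epsilon> i))"

definition uninformed_prob ::
  "nat \<Rightarrow> nat \<Rightarrow> (nat \<Rightarrow> real) \<Rightarrow> (nat \<Rightarrow> nat set) \<Rightarrow> nat \<Rightarrow> nat \<Rightarrow> real" where
  "uninformed_prob k t \<epsilon> W i n = measure_pmf.prob (state_pmf k t \<epsilon>) {S. \<not> informed W S i n}"

lemma uninformed_prob_le_1: "uninformed_prob k t \<epsilon> W i n \<le> 1"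
  by (simp add: uninformed_prob_def)

lemma uninformed_prob_0 [simp]: "uninformed_prob k t \<epsilon> W 0 n = 0"
  by (simp add: uninformed_prob_def)

lemma uninformed_prob_antimono:
  "n \<le> n' \<Longrightarrow> uninformed_prob k t \<epsilon> W i n' \<le> uninformed_prob k t \<epsilon> W i n"
  unfolding uninformed_prob_def
  by (rule measure_pmf.finite_measure_mono) (auto intro: informed_mono)

text \<open>The state \<open>S (i, n)\<close> is independent of who is informed at time
  \<open>n\<close>. Both tail estimates, for the converse and for the coding scheme, are inductions
  along this recursion.\<close>

lemma uninformed_prob_Suc:
  assumes "n \<in> W i" "i < k" "1 \<le> n" "n \<le> t" "0 \<le> \<epsilon> i" "\<epsilon> i \<le> 1"
  shows "uninformed_prob k t \<epsilon> W (Suc i) (Suc n) =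
    (1 - \<epsilon> i) * uninformed_prob k t \<epsilon> W i n + \<epsilon> i * uninformed_prob k t \<epsilon> W (Suc i) n"
proof -
  have "measure_pmf.prob (state_pmf k t \<epsilon>)
      {S. \<not> informed W S i n \<or> \<not> informed W S (Suc i) n \<and> \<not> S (i, n)} =
    (1 - \<epsilon> i) * measure_pmf.prob (state_pmf k t \<epsilon>) {S. \<not> informed W S i n} +
    (1 - (1 - \<epsilon> i)) * measure_pmf.prob (state_pmf k t \<epsilon>) {S. \<not> informed W S (Suc i) n}"
    using assms informed_pred
    by (intro prob_Pi_pmf_bernoulli_coordinate) (auto simp del: informed.simps simp: informed_update)
  then show ?thesis
    unfolding uninformed_prob_def not_informed_Suc[of n W i, OF assms(1)] by simp
qed

section \<open>Converse\<close>

text \<open>An uninformed node has received only erasures and symbols sent by an uninformed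
  predecessor, which by induction do not depend on the message.\<close>

lemma channel_input_uninformed:
  assumes "\<not> informed (\<lambda>_. {1..}) S i n"
  shows "channel_input src enc M S i n = channel_input src enc M' S i n"
  using assms
proof (induction i arbitrary: n)
  case (Suc i)
  have "map (erase S i (channel_input src enc M S i)) [1..<n] =
      map (erase S i (channel_input src enc M' S i)) [1..<n]"
    using Suc.IH Suc.prems by (fastforce simp: erase_def)
  then show ?case
    by (simp only: channel_input.simps)
qed simp

text \<open>The estimate at time \<open>t\<close> also uses the output of time \<open>t\<close>,
  whereas \<open>informed\<close> looks strictly into the past; hence \<open>Suc t\<close>.\<close>

lemma channel_output_uninformed:
  assumes "\<not> informed (\<lambda>_. {1..}) S (Suc i) (Suc t)"
  shows "map (channel_output src enc M S i) [1..<Suc t] =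
    map (channel_output src enc M' S i) [1..<Suc t]"
proof (rule map_cong[OF refl])
  fix n assume "n \<in> set [1..<Suc t]"
  then have "\<not> informed (\<lambda>_. {1..}) S i n \<or> \<not> S (i, n)"
    using assms by auto
  then show "channel_output src enc M S i n = channel_output src enc M' S i n"
    using channel_input_uninformed[of S i n src enc M M']
    by (auto simp: channel_output_def erase_def)
qed

text \<open>When the states leave node \<open>k\<close> uninformed, the estimate is a constant, and
  a uniform message with at least two values differs from it with probability at least one
  half.\<close>

lemma error_prob_ge:
  assumes "k \<ge> 1" "m \<ge> 1"
  shows "error_prob m k t \<epsilon> src enc dec \<ge>
    uninformed_prob k t \<epsilon> (\<lambda>_. {1..}) k (Suc t) / 2"
proof -
  define U where "U = pmf_of_set {0..<(2::nat) ^ m}"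
  define Err where
    "Err = {(M, S). dec (map (channel_output src enc M S (k - 1)) [1..<Suc t]) \<noteq> M}"
  \<comment> \<open>Drawing the states first keeps the message uniform for each fixed
    realization.\<close>
  have tandem: "tandem_pmf m k t \<epsilon> = state_pmf k t \<epsilon> \<bind> (\<lambda>S. map_pmf (\<lambda>M. (M, S)) U)"
    unfolding tandem_pmf_def U_def pair_pmf_def map_pmf_def
    by (subst bind_commute_pmf) simp
  have half: "1 / 2 \<le> measure_pmf.prob U {M. c \<noteq> M}" for c
  proof -
    have "measure_pmf.prob U {c} \<le> 1 / 2 ^ m"
      unfolding U_def by (subst measure_pmf_of_set) (auto simp: divide_simps card_insert_if Int_insert_right)
    also have "(1 :: real) / 2 ^ m \<le> 1 / 2 ^ 1"
      using assms by (intro divide_left_mono power_increasing) auto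
    finally have "1 - measure_pmf.prob U {c} \<ge> 1 / 2"
      by simp
    also have "1 - measure_pmf.prob U {c} = measure_pmf.prob U (UNIV - {c})"
      by (subst measure_pmf.prob_compl[symmetric]) auto
    also have "UNIV - {c} = {M. c \<noteq> M}"
      by auto
    finally show ?thesis .
  qed
  have fibre: "indicat_real {S. \<not> informed (\<lambda>_. {1..}) S k (Suc t)} S / 2 \<le>
      measure_pmf.prob (map_pmf (\<lambda>M. (M, S)) U) Err" for S
  proof (cases "informed (\<lambda>_. {1..}) S k (Suc t)")
    case False
    define c where "c = dec (map (channel_output src enc 0 S (k - 1)) [1..<Suc t])"
    have "dec (map (channel_output src enc M S (k - 1)) [1..<Suc t]) = c" for M
      unfolding c_def using False assms(1)
      by (intro arg_cong[of _ _ dec] channel_output_uninformed) auto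
    then have "(\<lambda>M. (M, S)) -` Err = {M. c \<noteq> M}"
      by (auto simp: Err_def simp del: upt_Suc)
    then show ?thesis
      using half[of c] False by simp
  qed simp
  have "uninformed_prob k t \<epsilon> (\<lambda>_. {1..}) k (Suc t) / 2 =
      (\<integral>S. indicat_real {S. \<not> informed (\<lambda>_. {1..}) S k (Suc t)} S / 2 \<partial>state_pmf k t \<epsilon>)"
    by (simp add: uninformed_prob_def)
  also have "\<dots> \<le> (\<integral>S. measure_pmf.prob (map_pmf (\<lambda>M. (M, S)) U) Err \<partial>state_pmf k t \<epsilon>)"
    by (intro integral_mono fibre measure_pmf.integrable_const_bound[where B = 1]) 
       (auto simp: indicator_def)
  also have "\<dots> = error_prob m k t \<epsilon> src enc dec"
    unfolding error_prob_def tandem prob_bind_pmf Err_def ..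
  finally show ?thesis .
qed

text \<open>A Chernoff bound: \<open>1 + \<mu> / (1 - \<epsilon> l)\<close> is the reciprocal of the
  generating function, at \<open>1 / (1 + \<mu>)\<close>, of a geometric variable with mean
  \<open>1 / (1 - \<epsilon> l)\<close>. The right side solves the recursion exactly, so a double
  induction suffices.\<close>

lemma informed_prob_le:
  assumes "\<And>i. 0 \<le> \<epsilon> i \<and> \<epsilon> i < 1" "0 \<le> \<mu>" "i \<le> k" "n \<le> Suc t"
  shows "1 - uninformed_prob k t \<epsilon> (\<lambda>_. {1..}) i n \<le>
    (1 + \<mu>) ^ n / (\<Prod>l<i. 1 + \<mu> / (1 - \<epsilon> l))"
  using assms(3,4)
proof (induction i arbitrary: n)
  case 0
  then show ?case using assms(2) by simp
next
  case (Suc i)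
  let ?q = "uninformed_prob k t \<epsilon> (\<lambda>_. {1..})"
  let ?P = "\<lambda>i. \<Prod>l<i. 1 + \<mu> / (1 - \<epsilon> l)"
  note IH = Suc.IH[OF Suc_leD[OF Suc.prems(1)]]
  have P: "?P i > 0" for i
    using assms(1,2) by (intro prod_pos ballI add_pos_nonneg divide_nonneg_pos) auto
  show ?case
    using \<open>n \<le> Suc t\<close>
  proof (induction n)
    case 0
    have "?q (Suc i) 0 = 1"
      by (simp add: uninformed_prob_def)
    then show ?case
      using P[of "Suc i"] by simp
  next
    case (Suc n)
    show ?case
    \<comment> \<open>Transmission begins at time 1, so the recursion cannot lead from time 0 to
      time 1; at time 1 node \<open>i + 1\<close> is surely uninformed.\<close>
    proof (cases "n = 0")
      case True
      have "?q (Suc i) (Suc 0) = 1"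
        by (simp add: uninformed_prob_def)
      then show ?thesis
        using P[of "Suc i"] True assms(2) by simp
    next
      case False
      define e where "e = \<epsilon> i"
      have e: "0 \<le> e" "e < 1"
        using assms(1) by (auto simp: e_def)
      define a where "a = (1 + \<mu>) ^ n / ?P i"
      have PS: "?P (Suc i) = ?P i * (1 + \<mu> / (1 - e))"
        by (simp add: e_def)
      have c: "1 + \<mu> / (1 - e) > 0"
        using e assms(2) by (auto intro!: add_pos_nonneg)
      have "1 - ?q (Suc i) (Suc n) = (1 - e) * (1 - ?q i n) + e * (1 - ?q (Suc i) n)"
        unfolding e_def using False Suc.prems \<open>Suc i \<le> k\<close> assms(1)[of i]
        by (subst uninformed_prob_Suc) (auto simp: algebra_simps)
      also have "\<dots> \<le> (1 - e) * a + e * (a / (1 + \<mu> / (1 - e)))"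
        using Suc.IH Suc.prems IH[of n] e
        by (intro add_mono mult_left_mono) (auto simp: a_def PS[unfolded e_def] e_def)
      also have "\<dots> = (1 + \<mu>) * a / (1 + \<mu> / (1 - e))"
      proof -
        have "1 - e + \<mu> > 0" using e assms(2) by simp
        moreover have "1 + \<mu> / (1 - e) = (1 - e + \<mu>) / (1 - e)"
          using e by (simp add: field_simps)
        ultimately show ?thesis
          using e by (simp add: divide_simps) (simp add: algebra_simps)
      qed
      also have "\<dots> = (1 + \<mu>) ^ Suc n / ?P (Suc i)"
        by (simp add: a_def e_def)
      finally show ?thesis .
    qed
  qed
qed

section \<open>Achievability\<close>

text \<open>With \<open>x = r / (1 - e)\<close>, the bound \<open>1 - r \<le> exp (- r)\<close>
  reduces the claim to \<open>- ln (1 - x) \<le> x + \<delta> * x\<close>. The slack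
  \<open>\<delta>\<close> of the schedule absorbs the quadratic term of the logarithm.\<close>

lemma geometric_drift:
  fixes e \<delta> r :: real
  assumes "0 \<le> e" "e < 1" "0 < r" "2 * r / (1 - e) \<le> \<delta>" "r / (1 - e) \<le> 1 / 2"
  shows "1 - e + e * exp (r * ((1 + \<delta>) / (1 - e))) \<le> exp (r * ((1 + \<delta>) / (1 - e) - 1))"
proof -
  define x where "x = r / (1 - e)"
  define b where "b = (1 + \<delta>) / (1 - e)"
  have x: "0 < x" "x \<le> 1 / 2" "2 * x \<le> \<delta>"
    using assms by (auto simp: x_def)
  have rb: "r * b = x + \<delta> * x"
    by (simp add: x_def b_def add_divide_distrib algebra_simps)
  have "- ln (1 - x) \<le> x + 2 * x\<^sup>2"
    using ln_one_minus_pos_lower_bound[of x] x by simp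
  also have "\<dots> \<le> r * b"
    using x mult_right_mono[of "2 * x" \<delta> x] by (simp add: rb power2_eq_square)
  finally have "exp (- ln (1 - x)) \<le> exp (r * b)"
    by simp
  then have "1 / (1 - x) \<le> exp (r * b)"
    using x by (simp add: exp_minus inverse_eq_divide)
  then have "1 \<le> exp (r * b) * (1 - x)"
    using x by (simp add: divide_simps)
  then have "(1 - e) * 1 \<le> (1 - e) * (exp (r * b) * (1 - x))"
    using assms by (intro mult_left_mono) auto
  also have "\<dots> = exp (r * b) * (1 - r - e)"
    using assms by (simp add: x_def field_simps)
  also have "\<dots> \<le> exp (r * b) * (exp (- r) - e)"
    using exp_ge_add_one_self[of "- r"] by (intro mult_left_mono) auto
  also have "\<dots> = exp (r * (b - 1)) - e * exp (r * b)"
    by (simp add: algebra_simps flip: exp_add)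
  finally show ?thesis
    by (simp add: b_def)
qed

text \<open>Half-open intervals with real endpoints: for positive \<open>w\<close> they tile the
  times after \<open>s i\<close>, and the schedule needs no rounding.\<close>

definition window :: "(nat \<Rightarrow> real) \<Rightarrow> real \<Rightarrow> nat \<Rightarrow> nat \<Rightarrow> nat set" where
  "window s w j i = {n. s i + real j * w < real n \<and> real n \<le> s i + real (Suc j) * w}"

lemma window_disjoint:
  assumes "n \<in> window s w j i" "n \<in> window s w j' i" "0 \<le> w"
  shows "j = j'"
proof (rule ccontr)
  have *: False if "n \<in> window s w j i" "n \<in> window s w j' i" "Suc j \<le> j'" for j j'
  proof -
    have "real (Suc j) * w \<le> real j' * w"
      using that assms by (intro mult_right_mono) auto
    then show False
      using that by (auto simp: window_def)
  qed
  assume "j \<noteq> j'"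
  then show False
    using *[of j j'] *[of j' j] assms by linarith
qed

text \<open>
  Relative to its schedule \<open>s\<close> the front of a bit is a random walk with negative drift that is
  reflected where the window opens. The exponential is its Lyapunov function; each hop adds
  \<open>exp (r * (B - w))\<close> for the event that the front misses the end of the window.
\<close>

lemma uninformed_prob_window:
  fixes s :: "nat \<Rightarrow> real"
  assumes \<epsilon>: "\<And>i. 0 \<le> \<epsilon> i \<and> \<epsilon> i \<le> 1"
    and s: "\<And>i. 0 \<le> s i" "\<And>i. s i + 1 \<le> s (Suc i)" "\<And>i. s (Suc i) - s i \<le> B"
    and drift: "\<And>i. 1 - \<epsilon> i + \<epsilon> i * exp (r * (s (Suc i) - s i)) \<le> exp (r * (s (Suc i) - s i - 1))"
    and "0 < r" "0 \<le> w" "i \<le> k" "n \<le> t" "real n \<le> s i + real (Suc j) * w"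
  shows "uninformed_prob k t \<epsilon> (window s w j) i n \<le>
    exp (r * (s i + real j * w - real n)) + real i * exp (r * (B - w))"
  using \<open>i \<le> k\<close> \<open>n \<le> t\<close> \<open>real n \<le> s i + real (Suc j) * w\<close>
proof (induction i arbitrary: n)
  case (Suc i)
  let ?q = "uninformed_prob k t \<epsilon> (window s w j)"
  define \<eta> where "\<eta> = exp (r * (B - w))"
  define u where "u = s i + real (Suc j) * w"
  note IH = Suc.IH[OF Suc_leD[OF Suc.prems(1)]]
  have "0 \<le> \<eta>" by (simp add: \<eta>_def)
  have u: "0 \<le> u"
    using s(1)[of i] \<open>0 \<le> w\<close> by (simp add: u_def)
  \<comment> \<open>Up to \<open>u + 1\<close>, with \<open>u\<close> the end of the window of node
    \<open>i\<close>, the bound is trivial or follows from the recursion, and the error term does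
    not grow.\<close>
  have main: "?q (Suc i) n \<le> exp (r * (s (Suc i) + real j * w - real n)) + real i * \<eta>"
    if "n \<le> t" "real n \<le> u + 1" for n
    using that
  proof (induction n)
    case 0
    have "0 \<le> r * (s (Suc i) + real j * w)"
      using s(1)[of "Suc i"] \<open>0 < r\<close> \<open>0 \<le> w\<close> by simp
    then have "1 \<le> exp (r * (s (Suc i) + real j * w))"
      by simp
    then show ?case
      using uninformed_prob_le_1[of k t \<epsilon> "window s w j" "Suc i" 0] \<open>0 \<le> \<eta>\<close>
      by (smt (verit) mult_nonneg_nonneg of_nat_0 of_nat_0_le_iff)
  next
    case (Suc n)
    show ?case
    \<comment> \<open>Until the window of node \<open>i + 1\<close> opens, the exponential is at
      least one: this is the reflection.\<close>
    proof (cases "real (Suc n) \<le> s (Suc i) + real j * w")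
      case True
      then have "0 \<le> r * (s (Suc i) + real j * w - real (Suc n))"
        using \<open>0 < r\<close> by (intro mult_nonneg_nonneg) auto
      then have "1 \<le> exp (r * (s (Suc i) + real j * w - real (Suc n)))"
        by simp
      then show ?thesis
        using uninformed_prob_le_1[of k t \<epsilon> "window s w j" "Suc i" "Suc n"] \<open>0 \<le> \<eta>\<close>
        by (smt (verit) mult_nonneg_nonneg of_nat_0_le_iff)
    next
      case False
      define X where "X = exp (r * (s i + real j * w - real n))"
      define b where "b = s (Suc i) - s i"
      \<comment> \<open>The schedule advances by at least one per hop, so a time
        \<open>n + 1\<close> past the opening at node \<open>i + 1\<close> has \<open>n\<close> past
        the opening at node \<open>i\<close>.\<close>
      have n: "n \<in> window s w j i"
        using False Suc.prems s(2)[of i] by (auto simp: window_def u_def)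
      have "0 \<le> s i + real j * w"
        using s(1)[of i] \<open>0 \<le> w\<close> by simp
      then have "n \<noteq> 0"
        using n by (auto simp: window_def)
      have "?q (Suc i) (Suc n) = (1 - \<epsilon> i) * ?q i n + \<epsilon> i * ?q (Suc i) n"
        using n \<open>n \<noteq> 0\<close> Suc.prems \<open>Suc i \<le> k\<close> \<epsilon> by (intro uninformed_prob_Suc) auto
      also have "\<dots> \<le> (1 - \<epsilon> i) * (X + real i * \<eta>) +
          \<epsilon> i * (exp (r * (s (Suc i) + real j * w - real n)) + real i * \<eta>)"
      proof (intro add_mono mult_left_mono)
        show "?q i n \<le> X + real i * \<eta>"
          unfolding X_def \<eta>_def
          using Suc.prems n by (intro IH) (auto simp: window_def)
        show "?q (Suc i) n \<le> exp (r * (s (Suc i) + real j * w - real n)) + real i * \<eta>"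
          using Suc.prems by (intro Suc.IH) auto
      qed (use \<epsilon>[of i] in auto)
      also have "exp (r * (s (Suc i) + real j * w - real n)) = X * exp (r * b)"
        by (simp add: X_def b_def algebra_simps flip: exp_add)
      also have "(1 - \<epsilon> i) * (X + real i * \<eta>) + \<epsilon> i * (X * exp (r * b) + real i * \<eta>) =
          X * (1 - \<epsilon> i + \<epsilon> i * exp (r * b)) + real i * \<eta>"
        by (simp add: algebra_simps)
      also have "\<dots> \<le> X * exp (r * (b - 1)) + real i * \<eta>"
        using drift[of i] by (intro add_right_mono mult_left_mono) (auto simp: X_def b_def)
      also have "X * exp (r * (b - 1)) = exp (r * (s (Suc i) + real j * w - real (Suc n)))"
        by (simp add: X_def b_def algebra_simps flip: exp_add)
      finally show ?thesis .
    qed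
  qed
  show ?case
  proof (cases "real n \<le> u + 1")
    case True
    have "real i * \<eta> \<le> real (Suc i) * \<eta>"
      using \<open>0 \<le> \<eta>\<close> by (intro mult_right_mono) auto
    then show ?thesis
      using main[OF Suc.prems(2) True] unfolding \<eta>_def by linarith
  next
    case False
    \<comment> \<open>The first integer beyond the window of node \<open>i\<close>. There the
      exponential has dropped to at most \<open>\<eta>\<close>, the extra term of this hop; later
      times follow by monotonicity.\<close>
    define n0 where "n0 = nat \<lfloor>u\<rfloor> + 1"
    have n0: "real n0 \<le> u + 1" "u < real n0"
      using u by (auto simp: n0_def) linarith+
    then have "n0 \<le> n"
      using False by linarith
    then have "?q (Suc i) n \<le> ?q (Suc i) n0"
      by (rule uninformed_prob_antimono)
    also have "\<dots> \<le> exp (r * (s (Suc i) + real j * w - real n0)) + real i * \<eta>"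
      using n0 \<open>n0 \<le> n\<close> Suc.prems by (intro main) auto
    also have "exp (r * (s (Suc i) + real j * w - real n0)) \<le> \<eta>"
      unfolding \<eta>_def exp_le_cancel_iff
      using n0 s(3)[of i] \<open>0 < r\<close> by (intro mult_left_mono) (auto simp: u_def algebra_simps)
    finally have "?q (Suc i) n \<le> real (Suc i) * \<eta>"
      by (simp add: algebra_simps)
    then show ?thesis
      by (simp add: \<eta>_def add_increasing)
  qed
qed simp

section \<open>The relay code and its error probability\<close>

definition relay_src :: "nat \<Rightarrow> (nat \<Rightarrow> nat \<Rightarrow> nat set) \<Rightarrow> nat \<Rightarrow> nat \<Rightarrow> bool" where
  "relay_src m W n M = (\<exists>j<m. n \<in> W j 0 \<and> bit M j)"

text \<open>Zero is the default symbol and ones are only repeated, so a one is never spurious. List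
  positions start at 0 and times at 1, hence \<open>n' - 1\<close>.\<close>

definition relay_enc ::
  "nat \<Rightarrow> (nat \<Rightarrow> nat \<Rightarrow> nat set) \<Rightarrow> nat \<Rightarrow> nat \<Rightarrow> bool option list \<Rightarrow> bool" where
  "relay_enc m W i n ys =
     (\<exists>j<m. n \<in> W j i \<and> (\<exists>n'<n. n' \<in> W j (i - 1) \<and> ys ! (n' - 1) = Some True))"

text \<open>Exactly one \<open>m\<close>-bit number has the prescribed bits, so the choice is
  determined.\<close>

definition relay_dec ::
  "nat \<Rightarrow> (nat \<Rightarrow> nat \<Rightarrow> nat set) \<Rightarrow> nat \<Rightarrow> nat \<Rightarrow> bool option list \<Rightarrow> nat" where
  "relay_dec m W k t ys =
     (SOME M. M < 2 ^ m \<and>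
       (\<forall>j<m. bit M j \<longleftrightarrow> (\<exists>n<Suc t. n \<in> W j (k - 1) \<and> ys ! (n - 1) = Some True)))"

lemma erase_list_nth_iff:
  "1 \<le> n' \<Longrightarrow> n' < n \<Longrightarrow>
    map (erase S i x) [1..<n] ! (n' - 1) = Some True \<longleftrightarrow> x n' \<and> S (i, n')"
  by (simp add: erase_def)

text \<open>Disjoint windows at each node decouple the bits: a symbol sent in window
  \<open>j\<close> concerns bit \<open>j\<close> only, and each set bit spreads as its own
  percolation.\<close>

lemma relay_input:
  assumes disj: "\<forall>i j j' n. n \<in> W j i \<longrightarrow> n \<in> W j' i \<longrightarrow> j = j'"
    and pos: "\<forall>i j n. n \<in> W j i \<longrightarrow> 1 \<le> n"
    and "j < m" "n \<in> W j i"
  shows "channel_input (relay_src m W) (relay_enc m W) M S i n \<longleftrightarrow> bit M j \<and> informed (W j) S i n"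
  using \<open>n \<in> W j i\<close>
proof (induction i arbitrary: n)
  case 0
  then show ?case
    using \<open>j < m\<close> disj by (auto simp: relay_src_def)
next
  case (Suc i)
  let ?X = "channel_input (relay_src m W) (relay_enc m W) M S i"
  have "(\<exists>n'<n. n' \<in> W j i \<and> map (erase S i ?X) [1..<n] ! (n' - 1) = Some True) \<longleftrightarrow>
      (\<exists>n'<n. n' \<in> W j i \<and> ?X n' \<and> S (i, n'))"
    using pos by (intro ex_cong conj_cong refl erase_list_nth_iff) blast+
  also have "\<dots> \<longleftrightarrow> bit M j \<and> informed (W j) S (Suc i) n"
    using Suc.IH by auto
  finally have received: "(\<exists>n'<n. n' \<in> W j i \<and> map (erase S i ?X) [1..<n] ! (n' - 1) = Some True) \<longleftrightarrow>
      bit M j \<and> informed (W j) S (Suc i) n" .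
  have "relay_enc m W (Suc i) n ys \<longleftrightarrow>
      (\<exists>n'<n. n' \<in> W j i \<and> ys ! (n' - 1) = Some True)" for ys
    unfolding relay_enc_def diff_Suc_1 using Suc.prems \<open>j < m\<close> disj by blast
  then show ?case
    by (simp only: channel_input.simps received)
qed

lemma relay_dec_correct:
  assumes disj: "\<forall>i j j' n. n \<in> W j i \<longrightarrow> n \<in> W j' i \<longrightarrow> j = j'"
    and pos: "\<forall>i j n. n \<in> W j i \<longrightarrow> 1 \<le> n"
    and "1 \<le> k" "M < 2 ^ m" and inf: "\<And>j. j < m \<Longrightarrow> informed (W j) S k (Suc t)"
  shows "relay_dec m W k t
    (map (channel_output (relay_src m W) (relay_enc m W) M S (k - 1)) [1..<Suc t]) = M"
proof -
  let ?X = "channel_input (relay_src m W) (relay_enc m W) M S (k - 1)"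
  let ?Y = "channel_output (relay_src m W) (relay_enc m W) M S (k - 1)"
  have received: "(\<exists>n<Suc t. n \<in> W j (k - 1) \<and> map ?Y [1..<Suc t] ! (n - 1) = Some True) \<longleftrightarrow>
      bit M j" if "j < m" for j
  proof -
    have "(\<exists>n<Suc t. n \<in> W j (k - 1) \<and> map ?Y [1..<Suc t] ! (n - 1) = Some True) \<longleftrightarrow>
        (\<exists>n<Suc t. n \<in> W j (k - 1) \<and> ?X n \<and> S (k - 1, n))"
      unfolding channel_output_def
      using pos by (intro ex_cong conj_cong refl erase_list_nth_iff) blast+
    also have "\<dots> \<longleftrightarrow> bit M j \<and> informed (W j) S (Suc (k - 1)) (Suc t)"
      using relay_input[OF disj pos that, of _ "k - 1" M S] by auto
    finally show ?thesis
      using inf[OF that] \<open>1 \<le> k\<close> by simp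
  qed
  show ?thesis
    unfolding relay_dec_def
  proof (rule some_equality)
    show "M' = M" if "M' < 2 ^ m \<and> (\<forall>j<m. bit M' j \<longleftrightarrow>
        (\<exists>n<Suc t. n \<in> W j (k - 1) \<and> map ?Y [1..<Suc t] ! (n - 1) = Some True))" for M'
    proof -
      have "take_bit m M' = take_bit m M"
        using that received by (intro bit_eqI) (auto simp: bit_take_bit_iff)
      then show ?thesis
        using that \<open>M < 2 ^ m\<close> by (simp add: take_bit_nat_eq_self)
    qed
  qed (use received \<open>M < 2 ^ m\<close> in blast)
qed

text \<open>A union bound over the bits whose percolation fails to reach node \<open>k\<close> in
  time.\<close>

lemma error_prob_relay_le:
  assumes "\<forall>i j j' n. n \<in> W j i \<longrightarrow> n \<in> W j' i \<longrightarrow> j = j'"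
    and "\<forall>i j n. n \<in> W j i \<longrightarrow> 1 \<le> n"
    and "1 \<le> k"
  shows "error_prob m k t \<epsilon> (relay_src m W) (relay_enc m W) (relay_dec m W k t) \<le>
    (\<Sum>j<m. uninformed_prob k t \<epsilon> (W j) k (Suc t))"
proof -
  let ?B = "\<Union>j<m. {S. \<not> informed (W j) S k (Suc t)}"
  let ?P = "tandem_pmf m k t \<epsilon>"
  have "error_prob m k t \<epsilon> (relay_src m W) (relay_enc m W) (relay_dec m W k t) \<le>
      measure_pmf.prob ?P (snd -` ?B)"
    unfolding error_prob_def
  proof (rule measure_pmf.finite_measure_mono_AE)
    \<comment> \<open>Correct decoding needs \<open>M < 2 ^ m\<close>, which holds on the support of
      the law.\<close>
    show "AE x in ?P. x \<in> {(M, S). relay_dec m W k t (map (channel_output (relay_src m W)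
        (relay_enc m W) M S (k - 1)) [1..<Suc t]) \<noteq> M} \<longrightarrow> x \<in> snd -` ?B"
    proof -
      have "x \<in> snd -` ?B" if "x \<in> set_pmf ?P"
        and err: "relay_dec m W k t (map (channel_output (relay_src m W)
          (relay_enc m W) (fst x) (snd x) (k - 1)) [1..<Suc t]) \<noteq> fst x" for x
      proof (rule ccontr)
        assume "x \<notin> snd -` ?B"
        then have "\<And>j. j < m \<Longrightarrow> informed (W j) (snd x) k (Suc t)"
          by (auto simp del: informed.simps)
        moreover have "fst x < 2 ^ m"
          using that(1) by (auto simp: tandem_pmf_def)
        ultimately show False
          using relay_dec_correct[OF assms, of "fst x" m "snd x" t] err by blast
      qed
      then show ?thesis
        by (auto simp: AE_measure_pmf_iff case_prod_unfold simp del: upt_Suc)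
    qed
  qed simp
  also have "\<dots> = measure_pmf.prob (state_pmf k t \<epsilon>) ?B"
    unfolding measure_map_pmf[symmetric] tandem_pmf_def map_snd_pair_pmf ..
  also have "\<dots> \<le> (\<Sum>j<m. uninformed_prob k t \<epsilon> (W j) k (Suc t))"
    unfolding uninformed_prob_def
    by (rule measure_pmf.finite_measure_subadditive_finite) auto
  finally show ?thesis .
qed

section \<open>Asymptotics of the minimum delay\<close>

lemma min_delay_le:
  "error_prob m k t \<epsilon> src enc dec < \<xi> \<Longrightarrow> min_delay m k \<epsilon> \<xi> \<le> enat t"
  unfolding min_delay_def by (rule Inf_lower) blast

lemma min_delay_ge:
  assumes "\<And>t src enc dec. real t < y \<Longrightarrow> \<xi> \<le> error_prob m k t \<epsilon> src enc dec"
  shows "ereal y \<le> ereal_of_enat (min_delay m k \<epsilon> \<xi>)"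
proof -
  have "enat (nat \<lceil>y\<rceil>) \<le> min_delay m k \<epsilon> \<xi>"
    unfolding min_delay_def
  proof (rule Inf_greatest, clarify)
    fix t src enc dec
    assume "error_prob m k t \<epsilon> src enc dec < \<xi>"
    then have "y \<le> real t"
      using assms[of t src enc dec] by linarith
    then show "enat (nat \<lceil>y\<rceil>) \<le> enat t"
      by (simp add: ceiling_le_iff nat_le_iff)
  qed
  then have "ereal_of_enat (enat (nat \<lceil>y\<rceil>)) \<le> ereal_of_enat (min_delay m k \<epsilon> \<xi>)"
    by (simp only: ereal_of_enat_le_iff)
  moreover have "ereal y \<le> ereal_of_enat (enat (nat \<lceil>y\<rceil>))"
    by (simp add: real_nat_ceiling_ge)
  ultimately show ?thesis
    by (rule order_trans[rotated])
qed

text \<open>For \<open>t < y * k\<close> the Chernoff exponent is about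
  \<open>\<mu> * (y - z) * k\<close>, plus a quadratic loss \<open>(\<mu> * A)\<^sup>2\<close> per
  hop. For small \<open>\<mu>\<close> it is eventually below \<open>- ln 2\<close>; the error is
  then at least 1/4, which exceeds \<open>\<xi> k\<close>.\<close>

lemma eventually_min_delay_ge:
  assumes \<epsilon>: "\<And>i. 0 \<le> \<epsilon> i \<and> \<epsilon> i < 1" and A: "\<And>i. 1 / (1 - \<epsilon> i) \<le> A"
    and mean: "mean_hop_delay \<epsilon> \<longlonglongrightarrow> z" and "y < z"
    and m: "\<And>k. 1 \<le> k \<Longrightarrow> 1 \<le> m k" and \<xi>: "\<xi> \<longlonglongrightarrow> 0"
  shows "\<forall>\<^sub>F k in sequentially.
    ereal (y * real k) \<le> ereal_of_enat (min_delay (m k) k \<epsilon> (\<xi> k))"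
proof -
  define a where "a = (\<lambda>l. 1 / (1 - \<epsilon> l))"
  have a: "1 \<le> a l" "a l \<le> A" for l
    using \<epsilon>[of l] A[of l] by (auto simp: a_def)
  have "1 \<le> A"
    using a[of 0] by linarith
  \<comment> \<open>The first term keeps \<open>\<mu> * a l \<le> 1\<close>, as
    \<open>ln (1 + x) \<ge> x - x\<^sup>2\<close> requires; the second limits the quadratic loss to
    half of the gain.\<close>
  define \<mu> where "\<mu> = min (1 / A) ((z - y) / (2 * A\<^sup>2))"
  have \<mu>: "0 < \<mu>" "\<mu> * A \<le> 1" "\<mu> * A\<^sup>2 \<le> (z - y) / 2"
  proof -
    show "0 < \<mu>" using \<open>1 \<le> A\<close> \<open>y < z\<close> by (simp add: \<mu>_def)
    have "\<mu> * A \<le> 1 / A * A"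
      using \<open>1 \<le> A\<close> by (intro mult_right_mono) (auto simp: \<mu>_def)
    then show "\<mu> * A \<le> 1" using \<open>1 \<le> A\<close> by simp
    have "\<mu> * A\<^sup>2 \<le> (z - y) / (2 * A\<^sup>2) * A\<^sup>2"
      by (intro mult_right_mono) (auto simp: \<mu>_def)
    then show "\<mu> * A\<^sup>2 \<le> (z - y) / 2" using \<open>1 \<le> A\<close> by simp
  qed
  \<comment> \<open>Of the gap \<open>z - y\<close>, half pays for the quadratic loss and a quarter
    for the convergence of the mean; the last quarter leaves decay \<open>\<mu> * d\<close> per
    hop.\<close>
  define d where "d = (z - y) / 4"
  have "0 < d" using \<open>y < z\<close> by (simp add: d_def)
  have "\<forall>\<^sub>F k in sequentially. z - d < mean_hop_delay \<epsilon> k"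
    using mean \<open>0 < d\<close> by (intro order_tendstoD(1)) auto
  moreover have "\<forall>\<^sub>F k in sequentially. \<xi> k < 1 / 4"
    using \<xi> by (intro order_tendstoD(2)) auto
  moreover have "\<forall>\<^sub>F k in sequentially. (\<mu> + ln 2) / (\<mu> * d) \<le> real k"
    using filterlim_real_sequentially by (simp add: filterlim_at_top)
  ultimately show ?thesis
    using eventually_ge_at_top[of 1]
  proof eventually_elim
    case (elim k)
    show ?case
    proof (rule min_delay_ge)
      fix t src enc dec
      assume t: "real t < y * real k"
      let ?q = "uninformed_prob k t \<epsilon> (\<lambda>_. {1..}) k (Suc t)"
      have sum_a: "(\<Sum>l<k. a l) = real k * mean_hop_delay \<epsilon> k"
        using elim by (simp add: mean_hop_delay_def a_def)
      have "1 - ?q \<le> (1 + \<mu>) ^ Suc t / (\<Prod>l<k. 1 + \<mu> * a l)"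
        using informed_prob_le[of \<epsilon> \<mu> k k "Suc t" t] \<epsilon> \<mu> by (simp add: a_def)
      also have "\<dots> \<le> exp (\<mu> * real (Suc t)) / exp (\<Sum>l<k. \<mu> * a l - (\<mu> * A)\<^sup>2)"
      proof (rule frac_le)
        have "(1 + \<mu>) ^ Suc t \<le> exp \<mu> ^ Suc t"
          using \<mu> by (intro power_mono exp_ge_add_one_self) auto
        also have "\<dots> = exp (\<mu> * real (Suc t))"
          by (simp only: exp_of_nat2_mult)
        finally show "(1 + \<mu>) ^ Suc t \<le> exp (\<mu> * real (Suc t))" .
        show "exp (\<Sum>l<k. \<mu> * a l - (\<mu> * A)\<^sup>2) \<le> (\<Prod>l<k. 1 + \<mu> * a l)"
          unfolding exp_sum[OF finite_lessThan]
        proof (rule prod_mono, safe)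
          fix l
          have x: "0 \<le> \<mu> * a l" "\<mu> * a l \<le> \<mu> * A"
            using a[of l] \<mu> by auto
          have "\<mu> * a l - (\<mu> * A)\<^sup>2 \<le> \<mu> * a l - (\<mu> * a l)\<^sup>2"
            using x by (intro diff_left_mono power_mono)
          also have "\<dots> \<le> ln (1 + \<mu> * a l)"
            using x \<mu>(2) by (intro ln_one_plus_pos_lower_bound) linarith+
          finally show "exp (\<mu> * a l - (\<mu> * A)\<^sup>2) \<le> 1 + \<mu> * a l"
            using x by (subst ln_ge_iff[symmetric]) auto
        qed auto
      qed auto
      also have "\<dots> = exp (\<mu> * real (Suc t) - real k * \<mu> * mean_hop_delay \<epsilon> k + real k * (\<mu> * A)\<^sup>2)"
        by (simp add: sum_subtractf sum_distrib_left[symmetric] sum_a exp_diff[symmetric] algebra_simps)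
      also have "\<dots> \<le> exp (- ln 2)"
        unfolding exp_le_cancel_iff
      proof -
        have 1: "\<mu> * real (Suc t) \<le> \<mu> * (y * real k + 1)"
          using t \<mu> by (intro mult_left_mono) auto
        have 2: "real k * \<mu> * (z - d) \<le> real k * \<mu> * mean_hop_delay \<epsilon> k"
          using elim \<mu> by (intro mult_left_mono) auto
        have "real k * \<mu> * (\<mu> * A\<^sup>2) \<le> real k * \<mu> * ((z - y) / 2)"
          using \<mu> by (intro mult_left_mono) auto
        then have 3: "real k * (\<mu> * A)\<^sup>2 \<le> real k * \<mu> * ((z - y) / 2)"
          by (simp add: power2_eq_square algebra_simps)
        have 4: "\<mu> + ln 2 \<le> real k * \<mu> * d"
          using elim(3) \<open>0 < d\<close> \<mu> by (simp add: divide_simps mult_ac)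
        have "\<mu> * (y * real k + 1) - real k * \<mu> * (z - d) + real k * \<mu> * ((z - y) / 2) =
            \<mu> - real k * \<mu> * d"
          by (simp add: d_def field_simps)
        then show "\<mu> * real (Suc t) - real k * \<mu> * mean_hop_delay \<epsilon> k + real k * (\<mu> * A)\<^sup>2 \<le> - ln 2"
          using 1 2 3 4 by linarith
      qed
      finally have "1 / 2 \<le> ?q"
        by (simp add: exp_minus)
      moreover have "?q / 2 \<le> error_prob (m k) k t \<epsilon> src enc dec"
        using elim m by (intro error_prob_ge) auto
      ultimately show "\<xi> k \<le> error_prob (m k) k t \<epsilon> src enc dec"
        using elim by linarith
    qed
  qed
qed

text \<open>The relay code with \<open>m\<close> windows of length \<open>w\<close> finishes at node
  \<open>k\<close> by time \<open>s k + m * w\<close>.\<close>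

lemma min_delay_le_schedule:
  fixes \<epsilon> s :: "nat \<Rightarrow> real"
  assumes \<epsilon>: "\<And>i. 0 \<le> \<epsilon> i \<and> \<epsilon> i \<le> 1"
    and s: "\<And>i. 0 \<le> s i" "\<And>i. s i + 1 \<le> s (Suc i)" "\<And>i. s (Suc i) - s i \<le> B"
    and drift: "\<And>i. 1 - \<epsilon> i + \<epsilon> i * exp (r * (s (Suc i) - s i)) \<le> exp (r * (s (Suc i) - s i - 1))"
    and "0 < r" "1 \<le> k" "1 \<le> m" "0 < \<xi>" "\<xi> < 1"
  shows "ereal_of_enat (min_delay m k \<epsilon> \<xi>) \<le>
    ereal (s k + real m * (B + ln (2 * real m * (real k + 1) / \<xi>) / r))"
proof -
  \<comment> \<open>Chosen so that \<open>exp (r * (B - w))\<close> equals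
    \<open>\<xi> / (2 * m * (k + 1))\<close>: there are \<open>m\<close> bits, each with
    \<open>k + 1\<close> error terms of this size.\<close>
  define w where "w = B + ln (2 * real m * (real k + 1) / \<xi>) / r"
  define t where "t = nat \<lfloor>s k + real m * w\<rfloor>"
  define W where "W = window s w"
  have "1 \<le> B"
    using s(2,3)[of 0] by linarith
  have "1 * 1 \<le> 2 * real m * (real k + 1)"
    using \<open>1 \<le> m\<close> by (intro mult_mono) auto
  then have big: "1 \<le> 2 * real m * (real k + 1) / \<xi>"
    using \<open>0 < \<xi>\<close> \<open>\<xi> < 1\<close> by (simp add: divide_simps)
  have "1 \<le> w"
    using \<open>1 \<le> B\<close> \<open>0 < r\<close> ln_ge_zero[OF big] by (simp add: w_def add_increasing2)
  have nn: "0 \<le> s k + real j * w" for j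
    using s(1)[of k] \<open>1 \<le> w\<close> by simp
  have "r * (B - w) = - ln (2 * real m * (real k + 1) / \<xi>)"
    using \<open>0 < r\<close> by (simp add: w_def)
  then have \<eta>: "exp (r * (B - w)) = \<xi> / (2 * real m * (real k + 1))"
    using big by (simp add: exp_minus)
  have q: "uninformed_prob k t \<epsilon> (W j) k (Suc t) \<le> \<xi> / (2 * real m)" if "j < m" for j
  proof -
    \<comment> \<open>The last integer up to the end of window \<open>j\<close> at node
      \<open>k\<close>; rounding loses at most one, covered by \<open>1 \<le> B\<close>.\<close>
    define n where "n = nat \<lfloor>s k + real (Suc j) * w\<rfloor>"
    have "real (Suc j) * w \<le> real m * w"
      using that \<open>1 \<le> w\<close> by (intro mult_right_mono) auto
    then have "n \<le> t"
      unfolding n_def t_def by (intro nat_mono floor_mono) auto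
    have n: "real n \<le> s k + real (Suc j) * w" "s k + real (Suc j) * w - 1 \<le> real n"
      using nn[of "Suc j"] by (auto simp: n_def of_nat_nat)
    have "uninformed_prob k t \<epsilon> (W j) k (Suc t) \<le> uninformed_prob k t \<epsilon> (W j) k n"
      using \<open>n \<le> t\<close> by (intro uninformed_prob_antimono) auto
    also have "\<dots> \<le> exp (r * (s k + real j * w - real n)) + real k * exp (r * (B - w))"
      unfolding W_def
      using \<open>n \<le> t\<close> n \<open>1 \<le> w\<close> by (intro uninformed_prob_window assms) auto
    also have "exp (r * (s k + real j * w - real n)) \<le> exp (r * (B - w))"
      unfolding exp_le_cancel_iff
      using n \<open>1 \<le> B\<close> \<open>0 < r\<close> by (intro mult_left_mono) (auto simp: algebra_simps)
    also have "exp (r * (B - w)) + real k * exp (r * (B - w)) = (real k + 1) * exp (r * (B - w))"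
      by (simp add: algebra_simps)
    also have "\<dots> = \<xi> / (2 * real m)"
      unfolding \<eta> by simp
    finally show ?thesis
      by simp
  qed
  have "error_prob m k t \<epsilon> (relay_src m W) (relay_enc m W) (relay_dec m W k t) \<le>
      (\<Sum>j<m. uninformed_prob k t \<epsilon> (W j) k (Suc t))"
  proof (rule error_prob_relay_le)
    show "\<forall>i j j' n. n \<in> W j i \<longrightarrow> n \<in> W j' i \<longrightarrow> j = j'"
      using window_disjoint \<open>1 \<le> w\<close> unfolding W_def by fastforce
    show "\<forall>i j n. n \<in> W j i \<longrightarrow> 1 \<le> n"
    proof (intro allI impI)
      fix i j n assume "n \<in> W j i"
      moreover have "0 \<le> s i + real j * w"
        using s(1)[of i] \<open>1 \<le> w\<close> by simp
      ultimately have "0 < real n"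
        by (auto simp: W_def window_def)
      then show "1 \<le> n" by simp
    qed
  qed fact
  also have "\<dots> \<le> (\<Sum>j<m. \<xi> / (2 * real m))"
    using q by (intro sum_mono) auto
  \<comment> \<open>The sum is half of \<open>\<xi>\<close>, which gives the strict
    inequality.\<close>
  also have "\<dots> < \<xi>"
    using \<open>1 \<le> m\<close> \<open>0 < \<xi>\<close> by simp
  finally have "min_delay m k \<epsilon> \<xi> \<le> enat t"
    by (rule min_delay_le)
  then have "ereal_of_enat (min_delay m k \<epsilon> \<xi>) \<le> ereal_of_enat (enat t)"
    by (simp only: ereal_of_enat_le_iff)
  also have "\<dots> \<le> ereal (s k + real m * w)"
    using nn[of m] by (simp add: t_def of_nat_nat)
  finally show ?thesis
    by (simp add: w_def)
qed

text \<open>Hop \<open>i\<close> is allotted \<open>1 + \<delta>\<close> times its mean delay. The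
  windows then add only \<open>m\<close> times a logarithm, which both limit hypotheses make
  \<open>o(k)\<close>.\<close>

lemma eventually_min_delay_le:
  assumes \<epsilon>: "\<And>i. 0 \<le> \<epsilon> i \<and> \<epsilon> i < 1" and A: "\<And>i. 1 / (1 - \<epsilon> i) \<le> A"
    and mean: "mean_hop_delay \<epsilon> \<longlonglongrightarrow> z" and "0 < z" "z < y"
    and m: "\<And>k. 1 \<le> k \<Longrightarrow> 1 \<le> m k" and \<xi>: "\<And>k. 1 \<le> k \<Longrightarrow> 0 < \<xi> k \<and> \<xi> k < 1"
    and lim_m: "(\<lambda>k. real (m k) * ln (real k + 1) / real k) \<longlonglongrightarrow> 0"
    and lim_\<xi>: "(\<lambda>k. real (m k) * ln (1 / \<xi> k) / real k) \<longlonglongrightarrow> 0"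
  shows "\<forall>\<^sub>F k in sequentially.
    ereal_of_enat (min_delay (m k) k \<epsilon> (\<xi> k)) \<le> ereal (y * real k)"
proof -
  \<comment> \<open>Makes \<open>(1 + \<delta>) * z\<close> the midpoint of \<open>z\<close> and
    \<open>y\<close>.\<close>
  define \<delta> where "\<delta> = (y - z) / (2 * z)"
  have \<delta>: "0 < \<delta>" "(1 + \<delta>) * z < y"
    using \<open>0 < z\<close> \<open>z < y\<close> by (auto simp: \<delta>_def field_simps)
  have a: "1 \<le> 1 / (1 - \<epsilon> l)" for l
    using \<epsilon>[of l] by auto
  have "1 \<le> A"
    using a[of 0] A[of 0] by linarith
  \<comment> \<open>Meets both smallness conditions of \<open>geometric_drift\<close> for all hops
    at once, through the common bound \<open>A\<close>.\<close>
  define r where "r = min (\<delta> / (2 * A)) (1 / (2 * A))"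
  have "0 < r"
    using \<open>1 \<le> A\<close> \<delta> by (simp add: r_def)
  have rA: "2 * r * A \<le> \<delta>" "r * A \<le> 1 / 2"
  proof -
    have "2 * r * A \<le> 2 * (\<delta> / (2 * A)) * A"
      using \<open>1 \<le> A\<close> by (intro mult_right_mono mult_left_mono) (auto simp: r_def)
    then show "2 * r * A \<le> \<delta>" using \<open>1 \<le> A\<close> by simp
    have "r * A \<le> 1 / (2 * A) * A"
      using \<open>1 \<le> A\<close> by (intro mult_right_mono) (auto simp: r_def)
    then show "r * A \<le> 1 / 2" using \<open>1 \<le> A\<close> by simp
  qed
  define s where "s = (\<lambda>i. \<Sum>l<i. (1 + \<delta>) / (1 - \<epsilon> l))"
  define B where "B = (1 + \<delta>) * A"
  have "0 \<le> B"
    using \<delta> \<open>1 \<le> A\<close> by (simp add: B_def)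
  have step: "s (Suc i) - s i = (1 + \<delta>) * (1 / (1 - \<epsilon> i))" for i
    by (simp add: s_def)
  have bound: "ereal_of_enat (min_delay (m k) k \<epsilon> (\<xi> k)) \<le>
      ereal (s k + real (m k) * (B + ln (2 * real (m k) * (real k + 1) / \<xi> k) / r))"
    if "1 \<le> k" for k
  proof (rule min_delay_le_schedule)
    show "0 \<le> s i" for i
      using \<epsilon> \<delta> unfolding s_def by (intro sum_nonneg divide_nonneg_pos) auto
    show "s i + 1 \<le> s (Suc i)" for i
      using step[of i] mult_mono[of 1 "1 + \<delta>" 1 "1 / (1 - \<epsilon> i)"] a[of i] \<delta> by simp
    show "s (Suc i) - s i \<le> B" for i
      unfolding step B_def using A \<delta> by (intro mult_left_mono) auto
    show "1 - \<epsilon> i + \<epsilon> i * exp (r * (s (Suc i) - s i)) \<le> exp (r * (s (Suc i) - s i - 1))" for i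
    proof -
      have "r * (1 / (1 - \<epsilon> i)) \<le> r * A"
        using A[of i] \<open>0 < r\<close> by (intro mult_left_mono) auto
      then have "2 * r / (1 - \<epsilon> i) \<le> \<delta>" "r / (1 - \<epsilon> i) \<le> 1 / 2"
        using rA by (auto simp only: times_divide_eq_right mult_1_right)
      then show ?thesis
        using geometric_drift[of "\<epsilon> i" r \<delta>] \<epsilon>[of i] \<open>0 < r\<close> by (simp add: step)
    qed
  qed (use \<epsilon> \<open>0 < r\<close> that m \<xi> in \<open>auto simp: less_imp_le\<close>)
  let ?L = "\<lambda>k. real (m k) * ln (real k + 1) / real k"
  let ?X = "\<lambda>k. real (m k) * ln (1 / \<xi> k) / real k"
  \<comment> \<open>In \<open>w\<close>, the constant \<open>B\<close> and the three logarithms of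
    \<open>2\<close>, \<open>m k\<close> and \<open>k + 1\<close> are charged to
    \<open>ln (k + 1)\<close>, giving the coefficient \<open>B + 3 / r\<close>.\<close>
  have "(\<lambda>k. (1 + \<delta>) * mean_hop_delay \<epsilon> k + (B + 3 / r) * ?L k + 1 / r * ?X k) \<longlonglongrightarrow>
      (1 + \<delta>) * z + (B + 3 / r) * 0 + 1 / r * 0"
    by (intro tendsto_add tendsto_mult_left mean lim_m lim_\<xi>)
  then have "\<forall>\<^sub>F k in sequentially.
      (1 + \<delta>) * mean_hop_delay \<epsilon> k + (B + 3 / r) * ?L k + 1 / r * ?X k < y"
    using \<delta> by (intro order_tendstoD(2)) auto
  \<comment> \<open>Together with \<open>1 \<le> ln (k + 1)\<close> this forces
    \<open>m k < k\<close>, so that \<open>ln (m k)\<close> is at most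
    \<open>ln (k + 1)\<close>.\<close>
  moreover have "\<forall>\<^sub>F k in sequentially. ?L k < 1"
    using lim_m by (rule order_tendstoD(2)) simp
  moreover have "\<forall>\<^sub>F k in sequentially. 1 \<le> ln (real k + 1)"
    by real_asymp
  ultimately show ?thesis
    using eventually_ge_at_top[of 1]
  proof eventually_elim
    case (elim k)
    define M where "M = real (m k)"
    define l where "l = ln (real k + 1)"
    have "1 \<le> M" "0 < \<xi> k" "\<xi> k < 1" "1 \<le> l"
      using m[of k] \<xi>[of k] elim by (auto simp: M_def l_def)
    have "M * 1 \<le> M * l"
      using \<open>1 \<le> M\<close> \<open>1 \<le> l\<close> by (intro mult_left_mono) auto
    also have "\<dots> < real k"
      using elim by (simp add: M_def l_def divide_simps)
    finally have "ln M \<le> l"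
      unfolding l_def using \<open>1 \<le> M\<close> by (intro ln_mono) auto
    have "ln 2 \<le> l"
      unfolding l_def using elim by (intro ln_mono) auto
    have "ln (2 * M * (real k + 1) / \<xi> k) = ln 2 + ln M + l + ln (1 / \<xi> k)"
      using \<open>1 \<le> M\<close> \<open>0 < \<xi> k\<close> by (simp add: ln_mult ln_div l_def)
    also have "\<dots> \<le> 3 * l + ln (1 / \<xi> k)"
      using \<open>ln M \<le> l\<close> \<open>ln 2 \<le> l\<close> by simp
    finally have "B + ln (2 * M * (real k + 1) / \<xi> k) / r \<le> B * l + (3 * l + ln (1 / \<xi> k)) / r"
      using \<open>0 < r\<close> \<open>0 \<le> B\<close> \<open>1 \<le> l\<close> mult_left_mono[of 1 l B]
      by (intro add_mono divide_right_mono) auto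
    then have "M * (B + ln (2 * M * (real k + 1) / \<xi> k) / r) \<le>
        M * (B * l + (3 * l + ln (1 / \<xi> k)) / r)"
      using \<open>1 \<le> M\<close> by (intro mult_left_mono) auto
    also have "\<dots> = real k * ((B + 3 / r) * ?L k + 1 / r * ?X k)"
      unfolding M_def[symmetric] l_def[symmetric]
      using elim(4) \<open>0 < r\<close> by (simp add: field_simps)
    finally have "s k + M * (B + ln (2 * M * (real k + 1) / \<xi> k) / r) \<le>
        s k + real k * ((B + 3 / r) * ?L k + 1 / r * ?X k)"
      by simp
    also have "\<dots> = real k * ((1 + \<delta>) * mean_hop_delay \<epsilon> k + (B + 3 / r) * ?L k + 1 / r * ?X k)"
    proof -
      have "s k = real k * ((1 + \<delta>) * mean_hop_delay \<epsilon> k)"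
        using elim(4) by (simp add: s_def mean_hop_delay_def sum_distrib_left)
      then show ?thesis
        by (simp only: distrib_left add.assoc)
    qed
    also have "\<dots> \<le> real k * y"
      using elim(1) by (intro mult_left_mono) auto
    finally have "ereal (s k + M * (B + ln (2 * M * (real k + 1) / \<xi> k) / r)) \<le> ereal (y * real k)"
      by (simp add: mult.commute)
    then show ?case
      using bound[OF elim(4)] unfolding M_def by (rule order_trans[rotated])
  qed
qed

section \<open>From delay bounds to the information velocity\<close>

lemma tendsto_velocity:
  fixes D :: "nat \<Rightarrow> enat"
  assumes "0 < z"
    and ge: "\<And>y. y < z \<Longrightarrow> \<forall>\<^sub>F k in sequentially. ereal (y * real k) \<le> ereal_of_enat (D k)"
    and le: "\<And>y. z < y \<Longrightarrow> \<forall>\<^sub>F k in sequentially. ereal_of_enat (D k) \<le> ereal (y * real k)"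
  shows "(\<lambda>k. ereal (real k) / ereal_of_enat (D k)) \<longlonglongrightarrow> ereal (1 / z)"
proof (rule order_tendstoI)
  fix c assume "c < ereal (1 / z)"
  then have "max 0 c < ereal (1 / z)"
    using \<open>0 < z\<close> by simp
  then obtain b where b: "max 0 c < ereal b" "b < 1 / z"
    using ereal_dense2 ereal_less_eq by (metis less_ereal.simps(1))
  then have "0 < b" by simp
  then have "z < 1 / b"
    using b \<open>0 < z\<close> by (simp add: field_simps)
  from le[OF this] eventually_ge_at_top[of 1]
  show "\<forall>\<^sub>F k in sequentially. c < ereal (real k) / ereal_of_enat (D k)"
  proof eventually_elim
    case (elim k)
    then obtain d where d: "D k = enat d"
      by (cases "D k") auto
    have "ereal b \<le> ereal (real k) / ereal_of_enat (D k)"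
      \<comment> \<open>For delay 0 the quotient is infinite, and the lower bound still
        holds.\<close>
      using elim d \<open>0 < b\<close> by (cases "d = 0") (auto simp: field_simps)
    then show ?case
      using b by (auto intro: less_le_trans)
  qed
next
  fix c assume "ereal (1 / z) < c"
  then obtain b where b: "ereal b < c" "1 / z < b"
    using ereal_dense2 by (metis less_ereal.simps(1))
  moreover have "0 < 1 / z" using \<open>0 < z\<close> by simp
  ultimately have "0 < b" by linarith
  then have "1 / b < z"
    using b \<open>0 < z\<close> by (simp add: field_simps)
  from ge[OF this] eventually_ge_at_top[of 1]
  show "\<forall>\<^sub>F k in sequentially. ereal (real k) / ereal_of_enat (D k) < c"
  proof eventually_elim
    case (elim k)
    have "ereal (real k) / ereal_of_enat (D k) \<le> ereal b"
    proof (cases "D k")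
      \<comment> \<open>The lower bound on the delay excludes \<open>d = 0\<close>; in the remaining
        case of infinite delay the quotient is 0.\<close>
      case (enat d)
      then have "0 < real d"
        using elim enat \<open>0 < b\<close> by (cases "d = 0") (auto simp: field_simps)
      then show ?thesis
        using elim enat \<open>0 < b\<close> by (auto simp: field_simps)
    qed (use \<open>0 < b\<close> in simp)
    then show ?case
      using b by (auto intro: le_less_trans)
  qed
qed

text \<open>The common core of both regimes: the message size and the error target enter through the
  two limits that make the windows negligible. The supremum bound makes the mean hop delays
  uniformly bounded.\<close>

lemma info_velocity_eq:
  fixes \<epsilon> :: "nat \<Rightarrow> real"
  assumes \<epsilon>: "\<And>i. 0 < \<epsilon> i \<and> \<epsilon> i < 1" and sup: "(SUP i. \<epsilon> i) < 1"
    and conv: "convergent (mean_hop_delay \<epsilon>)"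
    and m: "\<And>k. 1 \<le> k \<Longrightarrow> 1 \<le> m k" and \<xi>: "\<And>k. 1 \<le> k \<Longrightarrow> 0 < \<xi> k \<and> \<xi> k < 1"
    and lim0: "\<xi> \<longlonglongrightarrow> 0"
    and lim_m: "(\<lambda>k. real (m k) * ln (real k + 1) / real k) \<longlonglongrightarrow> 0"
    and lim_\<xi>: "(\<lambda>k. real (m k) * ln (1 / \<xi> k) / real k) \<longlonglongrightarrow> 0"
  shows "info_velocity m \<epsilon> \<xi> = ereal (1 / zeta \<epsilon>)"
proof -
  have mean: "mean_hop_delay \<epsilon> \<longlonglongrightarrow> zeta \<epsilon>"
    using conv by (simp add: zeta_def convergent_LIMSEQ_iff)
  have \<epsilon>': "0 \<le> \<epsilon> i \<and> \<epsilon> i < 1" for i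
    using \<epsilon>[of i] by simp
  have A: "1 / (1 - \<epsilon> i) \<le> 1 / (1 - (SUP i. \<epsilon> i))" for i
  proof -
    have "bdd_above (range \<epsilon>)"
      using \<epsilon> by (intro bdd_aboveI[of _ 1]) (auto intro: less_imp_le)
    then have "\<epsilon> i \<le> (SUP i. \<epsilon> i)"
      by (intro cSUP_upper) auto
    then show ?thesis
      using sup \<epsilon>[of i] by (intro divide_left_mono) auto
  qed
  have "1 \<le> zeta \<epsilon>"
  proof (rule tendsto_lowerbound[OF mean])
    show "\<forall>\<^sub>F k in sequentially. 1 \<le> mean_hop_delay \<epsilon> k"
      using eventually_ge_at_top[of 1]
    proof eventually_elim
      case (elim k)
      have "(\<Sum>i<k. 1) \<le> (\<Sum>i<k. 1 / (1 - \<epsilon> i))"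
        using \<epsilon> by (intro sum_mono) (auto simp: less_imp_le)
      then show ?case
        using elim by (simp add: mean_hop_delay_def divide_simps)
    qed
  qed simp
  then have "0 < zeta \<epsilon>" by simp
  have "(\<lambda>k. ereal (real k) / ereal_of_enat (min_delay (m k) k \<epsilon> (\<xi> k))) \<longlonglongrightarrow> ereal (1 / zeta \<epsilon>)"
    using \<open>0 < zeta \<epsilon>\<close>
    by (intro tendsto_velocity eventually_min_delay_ge[OF \<epsilon>' A mean _ m lim0]
        eventually_min_delay_le[OF \<epsilon>' A mean _ _ m \<xi> lim_m lim_\<xi>])
  then show ?thesis
    unfolding info_velocity_def by (rule lim_imp_Liminf[OF sequentially_bot])
qed

theorem mainTheorem1:
  fixes \<epsilon> :: "nat \<Rightarrow> real"
  assumes "\<And>i. 0 < \<epsilon> i \<and> \<epsilon> i < 1"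
    and "(SUP i. \<epsilon> i) < 1"
    and "convergent (mean_hop_delay \<epsilon>)"
  shows "(\<forall>(m :: nat) (\<xi> :: nat \<Rightarrow> real).
            m \<ge> 1 \<longrightarrow>
            (\<forall>k\<ge>1. 0 < \<xi> k \<and> \<xi> k < 1) \<longrightarrow>
            \<xi> \<longlonglongrightarrow> 0 \<longrightarrow>
            (\<lambda>k. 1 / real k * ln (1 / \<xi> k)) \<longlonglongrightarrow> 0 \<longrightarrow>
            info_velocity (\<lambda>_. m) \<epsilon> \<xi> = ereal (1 / zeta \<epsilon>))
       \<and> (\<forall>(\<rho> :: real) (m :: nat \<Rightarrow> nat) (\<xi> :: nat \<Rightarrow> real).
            0 < \<rho> \<longrightarrow> \<rho> < 1 / 2 \<longrightarrow>
            (\<forall>k\<ge>1. m k \<ge> 1) \<longrightarrow>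
            (\<lambda>k. real (m k)) \<in> \<Theta>(\<lambda>k. real k powr \<rho>) \<longrightarrow>
            (\<forall>k\<ge>1. 0 < \<xi> k \<and> \<xi> k < 1) \<longrightarrow>
            \<xi> \<longlonglongrightarrow> 0 \<longrightarrow>
            (\<lambda>k. 1 / real k powr (1 - 2 * \<rho>) * ln (1 / \<xi> k)) \<longlonglongrightarrow> 0 \<longrightarrow>
            info_velocity m \<epsilon> \<xi> = ereal (1 / zeta \<epsilon>))"
proof (intro conjI allI impI)
  fix m :: nat and \<xi> :: "nat \<Rightarrow> real"
  assume "m \<ge> 1" and \<xi>: "\<forall>k\<ge>1. 0 < \<xi> k \<and> \<xi> k < 1" "\<xi> \<longlonglongrightarrow> 0"
    and lim: "(\<lambda>k. 1 / real k * ln (1 / \<xi> k)) \<longlonglongrightarrow> 0"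
  show "info_velocity (\<lambda>_. m) \<epsilon> \<xi> = ereal (1 / zeta \<epsilon>)"
  proof (rule info_velocity_eq)
    have "(\<lambda>k. ln (real k + 1) / real k) \<longlonglongrightarrow> 0"
      by real_asymp
    from tendsto_mult_left[OF this, of "real m"]
    show "(\<lambda>k. real m * ln (real k + 1) / real k) \<longlonglongrightarrow> 0"
      by simp
    show "(\<lambda>k. real m * ln (1 / \<xi> k) / real k) \<longlonglongrightarrow> 0"
      using tendsto_mult_left[OF lim, of "real m"] by simp
  qed (use assms \<xi> \<open>m \<ge> 1\<close> in auto)
next
  fix \<rho> :: real and m :: "nat \<Rightarrow> nat" and \<xi> :: "nat \<Rightarrow> real"
  assume \<rho>: "0 < \<rho>" "\<rho> < 1 / 2" and m: "\<forall>k\<ge>1. m k \<ge> 1"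
    and theta: "(\<lambda>k. real (m k)) \<in> \<Theta>(\<lambda>k. real k powr \<rho>)"
    and \<xi>: "\<forall>k\<ge>1. 0 < \<xi> k \<and> \<xi> k < 1" "\<xi> \<longlonglongrightarrow> 0"
    and lim: "(\<lambda>k. 1 / real k powr (1 - 2 * \<rho>) * ln (1 / \<xi> k)) \<longlonglongrightarrow> 0"
  obtain C where "0 < C"
    and C: "\<forall>\<^sub>F k in sequentially. norm (real (m k)) \<le> C * norm (real k powr \<rho>)"
    using bigthetaD1[OF theta] by (rule landau_o.bigE)
  \<comment> \<open>As \<open>m k\<close> is at most a constant times \<open>k powr \<rho>\<close>,
    both limits reduce to the decay of \<open>g k * k powr (\<rho> - 1)\<close>.\<close>
  have tendsto_m: "(\<lambda>k. real (m k) * g k / real k) \<longlonglongrightarrow> 0"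
    if g: "\<And>k. 1 \<le> k \<Longrightarrow> 0 \<le> g k" and lim: "(\<lambda>k. g k * real k powr (\<rho> - 1)) \<longlonglongrightarrow> 0" for g
  proof (rule tendsto_sandwich)
    show "\<forall>\<^sub>F k in sequentially. 0 \<le> real (m k) * g k / real k"
      using eventually_ge_at_top[of 1] by eventually_elim (use g in auto)
    show "\<forall>\<^sub>F k in sequentially. real (m k) * g k / real k \<le> C * (g k * real k powr (\<rho> - 1))"
      using C eventually_ge_at_top[of 1]
    proof eventually_elim
      case (elim k)
      then have "real (m k) * (g k / real k) \<le> C * real k powr \<rho> * (g k / real k)"
        using g[of k] by (intro mult_right_mono) auto
      then show ?case
        using elim by (simp add: powr_diff mult_ac)
    qed
    show "(\<lambda>k. C * (g k * real k powr (\<rho> - 1))) \<longlonglongrightarrow> 0"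
      using tendsto_mult_left[OF lim, of C] by simp
  qed simp
  show "info_velocity m \<epsilon> \<xi> = ereal (1 / zeta \<epsilon>)"
  proof (rule info_velocity_eq)
    show "(\<lambda>k. real (m k) * ln (real k + 1) / real k) \<longlonglongrightarrow> 0"
    proof (rule tendsto_m)
      show "(\<lambda>k. ln (real k + 1) * real k powr (\<rho> - 1)) \<longlonglongrightarrow> 0"
        using \<rho> by real_asymp
    qed simp
    show "(\<lambda>k. real (m k) * ln (1 / \<xi> k) / real k) \<longlonglongrightarrow> 0"
    proof (rule tendsto_m)
      \<comment> \<open>Since \<open>\<rho> - 1 = - \<rho> - (1 - 2 * \<rho>)\<close>, the required
        sequence is the hypothesis multiplied by \<open>k powr (- \<rho>)\<close>.\<close>
      have "(\<lambda>k. real k powr (- \<rho>)) \<longlonglongrightarrow> 0"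
        using \<rho> by real_asymp
      from tendsto_mult[OF this lim]
      have "(\<lambda>k. real k powr (- \<rho>) * (1 / real k powr (1 - 2 * \<rho>) * ln (1 / \<xi> k))) \<longlonglongrightarrow> 0"
        by simp
      also have "(\<lambda>k. real k powr (- \<rho>) * (1 / real k powr (1 - 2 * \<rho>) * ln (1 / \<xi> k))) =
          (\<lambda>k. ln (1 / \<xi> k) * real k powr (\<rho> - 1))"
      proof
        fix k
        have "real k powr (- \<rho>) / real k powr (1 - 2 * \<rho>) = real k powr (\<rho> - 1)"
          by (simp flip: powr_diff)
        moreover have "a * (1 / b * l) = l * (a / b)" for a b l :: real
          by simp
        ultimately show "real k powr (- \<rho>) * (1 / real k powr (1 - 2 * \<rho>) * ln (1 / \<xi> k)) =
            ln (1 / \<xi> k) * real k powr (\<rho> - 1)"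
          by metis
      qed
      finally show "(\<lambda>k. ln (1 / \<xi> k) * real k powr (\<rho> - 1)) \<longlonglongrightarrow> 0" .
      show "0 \<le> ln (1 / \<xi> k)" if "1 \<le> k" for k
        using \<xi>(1) that by (simp add: ln_ge_zero less_imp_le)
    qed
  qed (use assms \<xi> m in auto)
qed

end
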